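(* Let $G$ be a complete multi-partite graph of order $n$ with at least two partite sets, let $2\le q\le n-1$, and let $H\in\mathcal{M}_q(G)$ be such that $or_1(H)\ge or_1(H')$ for every $H'\in\mathcal{M}_q(G)$. Then: (i) $or_1(H)+or_3(H)=q$; (ii) if moreover $\mathrm{seq}(H)\succeq\mathrm{seq}(H')$ for every $H'\in\mathcal{M}_q(G)$, then $\mathrm{seq}(H)$ is either of the form $(h_1,\underbrace{h_2,\dots,h_2}_{t},h_3)$ with $t\ge 1$, $h_1\ge h_2\ge h_3$, and $h_3=h_2$ when $t=1$; or of the form $(h_1,\underbrace{h_2,\dots,h_2}_{t_1},\underbrace{1,\dots,1}_{t_2})$ with $t_1,t_2\ge 2$ and $h_1\ge h_2\ge 2$.
   Context: For a graph $H$ with components $H_1,\dots,H_s$ ($s=com(H)$ the number of components) ordered so that $|V(H_1)|\ge\dots\ge|V(H_s)|$, write $or_i(H)=|V(H_i)|$ and $\mathrm{seq}(H)=(or_1(H),\dots,or_s(H))$. $\mathcal{S}_q(G)$ is the set of disconnected spanning subgraphs $H$ of $G$ with $or_1(H)+or_2(H)\le q$; $\ell_q(G)$ is the maximum number of edges of a member of $\mathcal{S}_q(G)$, and $\mathcal{M}_q(G)$ is the set of members of $\mathcal{S}_q(G)$ with exactly $\ell_q(G)$ edges. For finite sequences, $(a_1,\dots,a_s)\succeq(b_1,\dots,b_t)$ means either $s=t$ and $a_i=b_i$ for all $i$, or there is $i\le\min\{s,t\}$ with $a_i>b_i$ and $a_j=b_j$ for all $j<i$ (lexicographic order). *)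

theory Defs
  imports
    "Graph_Theory.Digraph_Component"
    "HOL-Library.Multiset"
    "HOL-Library.Disjoint_Sets"
begin

text \<open>
  A finite simple graph is a \<^locale>\<open>pair_graph\<close>: a finite vertex set together with a symmetric,
  irreflexive set of arcs, each undirected edge \<open>{u, v}\<close> being represented by the two arcs
  \<open>(u, v)\<close> and \<open>(v, u)\<close>.
\<close>

definition complete_multipartite :: "'a pair_pre_digraph \<Rightarrow> 'a set set \<Rightarrow> bool" where
  "complete_multipartite G P \<longleftrightarrow>
     pair_graph G \<and> partition_on (pverts G) P \<and>
     parcs G = {(u, v). u \<in> pverts G \<and> v \<in> pverts G \<and> \<not> (\<exists>X\<in>P. u \<in> X \<and> v \<in> X)}"

text \<open>Undirected edges are counted, i.e. half the number of arcs.\<close>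

definition num_edges :: "'a pair_pre_digraph \<Rightarrow> nat" where
  "num_edges H = card {{u, v} | u v. (u, v) \<in> parcs H}"

text \<open>As the arc set is symmetric, the strongly connected components are the components.\<close>

definition components_verts :: "'a pair_pre_digraph \<Rightarrow> 'a set set" where
  "components_verts H = pre_digraph.sccs_verts (with_proj H)"

definition com :: "'a pair_pre_digraph \<Rightarrow> nat" where
  "com H = card (components_verts H)"

text \<open>The non-increasing list of the orders of the components, with multiplicities.\<close>

definition comp_seq :: "'a pair_pre_digraph \<Rightarrow> nat list" where
  "comp_seq H = rev (sorted_list_of_multiset (image_mset card (mset_set (components_verts H))))"

text \<open>
  The order of the \<open>i\<close>-th largest component; \<open>i\<close> counts from 1, list positions from 0.
  Only meaningful for \<open>1 \<le> i \<le> com H\<close>.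
\<close>

definition comp_ord :: "nat \<Rightarrow> 'a pair_pre_digraph \<Rightarrow> nat" where
  "comp_ord i H = comp_seq H ! (i - 1)"

text \<open>
  Membership in \<open>S_set\<close> requires \<open>pair_graph H\<close> since a \<^const>\<open>subgraph\<close> of a symmetric digraph
  need not be symmetric.
\<close>

definition S_set :: "nat \<Rightarrow> 'a pair_pre_digraph \<Rightarrow> 'a pair_pre_digraph set" where
  "S_set q G = {H. pair_graph H \<and> spanning (with_proj H) (with_proj G) \<and>
     \<not> connected (with_proj H) \<and> comp_ord 1 H + comp_ord 2 H \<le> q}"

definition ell :: "nat \<Rightarrow> 'a pair_pre_digraph \<Rightarrow> nat" where
  "ell q G = Max (num_edges ` S_set q G)"

definition M_set :: "nat \<Rightarrow> 'a pair_pre_digraph \<Rightarrow> 'a pair_pre_digraph set" where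
  "M_set q G = {H \<in> S_set q G. num_edges H = ell q G}"

text \<open>
  Unlike in the usual lexicographic order, a list and a proper prefix of it are incomparable.
\<close>

definition seq_succeq :: "nat list \<Rightarrow> nat list \<Rightarrow> bool" (infix "\<succeq>" 50) where
  "as \<succeq> bs \<longleftrightarrow> as = bs \<or>
     (\<exists>i < min (length as) (length bs). as ! i > bs ! i \<and> (\<forall>j < i. as ! j = bs ! j))"

end

theory Submission
  imports Defs
begin

text \<open>
  Let \<open>A\<close>, \<open>B\<close> be components of \<open>H\<close> with \<open>|A| \<ge> |B|\<close>. As \<open>G\<close> is complete multipartite, some vertex
  of \<open>B\<close> has at least as many \<open>G\<close>-neighbours in \<open>A\<close> as in \<open>B\<close>, so joining it to \<open>A\<close> instead of \<open>B\<close>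
  loses no edges. If \<open>or\<^sub>1 + or\<^sub>3 < q\<close>, moving a vertex from the second largest to the largest
  component stays within \<open>S_set\<close> and increases \<open>or\<^sub>1\<close>. Hence \<open>or\<^sub>1 + or\<^sub>3 = q\<close>, which forces
  \<open>or\<^sub>2 = or\<^sub>3\<close>. If the first order \<open>a\<close> below \<open>or\<^sub>2\<close> satisfies \<open>a \<ge> 2\<close> and is not the last one, moving
  a vertex from the next component into that one gives a lexicographically larger sequence.
\<close>

subsection \<open>Components of a finite graph\<close>

text \<open>Arcs are symmetric, so closure under arcs replaces the maximality of a strongly
  connected component: no path leaves a closed set. In this form components of a modified graph can
  be checked locally.\<close>

lemma components_verts_iff:
  assumes "pair_graph H"
  shows "S \<in> components_verts H \<longleftrightarrow> S \<noteq> {} \<and> S \<subseteq> pverts H \<and>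
    (\<forall>x y. x \<in> S \<longrightarrow> (x, y) \<in> parcs H \<longrightarrow> y \<in> S) \<and>
    (\<forall>x\<in>S. \<forall>y\<in>S. reachable (with_proj H) x y)"
proof -
  interpret pair_graph H by fact
  have sym: "(y, x) \<in> parcs H" if "(x, y) \<in> parcs H" for x y
    using graph_symmetric that by auto
  show ?thesis (is "?L \<longleftrightarrow> ?R")
  proof
    assume L: ?L
    then have "S \<subseteq> pverts H"
      unfolding components_verts_def by (rule sccs_verts_subsets)
    moreover have "y \<in> S" if "x \<in> S" "(x, y) \<in> parcs H" for x y
    proof (rule ccontr)
      assume "y \<notin> S"
      moreover have "reachable (with_proj H) x y" "reachable (with_proj H) y x"
        using that sym by auto
      ultimately show False
        using L \<open>x \<in> S\<close> unfolding components_verts_def in_sccs_verts_conv_reachable by blast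
    qed
    ultimately show ?R
      using L unfolding components_verts_def in_sccs_verts_conv_reachable by blast
  next
    assume R: ?R
    have "v \<in> S" if "reachable (with_proj H) u v" "u \<in> S" for u v
      using that by (induct rule: reachable_induct) (use R in auto)
    then show ?L
      using R unfolding components_verts_def in_sccs_verts_conv_reachable by blast
  qed
qed

lemma component_nonempty: "\<lbrakk>pair_graph H; S \<in> components_verts H\<rbrakk> \<Longrightarrow> S \<noteq> {}"
  and component_subset: "\<lbrakk>pair_graph H; S \<in> components_verts H\<rbrakk> \<Longrightarrow> S \<subseteq> pverts H"
  and component_closed:
    "\<lbrakk>pair_graph H; S \<in> components_verts H; x \<in> S; (x, y) \<in> parcs H\<rbrakk> \<Longrightarrow> y \<in> S"
  and component_reachable:
    "\<lbrakk>pair_graph H; S \<in> components_verts H; x \<in> S; y \<in> S\<rbrakk> \<Longrightarrow> reachable (with_proj H) x y"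
  by (simp_all add: components_verts_iff)

lemma partition_on_components_verts:
  assumes "pair_graph H"
  shows "partition_on (pverts H) (components_verts H)"
proof -
  interpret pair_graph H by fact
  have "\<Union>(components_verts H) = pverts H"
  proof
    show "\<Union>(components_verts H) \<subseteq> pverts H"
      by (intro Sup_least component_subset[OF assms])
    show "pverts H \<subseteq> \<Union>(components_verts H)"
      unfolding components_verts_def by (meson UnionI scc_of_in_sccs_verts in_scc_of_self subsetI)
  qed
  moreover have "{} \<notin> components_verts H"
    using component_nonempty[OF assms] by blast
  moreover have "disjoint (components_verts H)"
    unfolding disjoint_def components_verts_def using sccs_verts_disjoint by blast
  ultimately show ?thesis by (auto simp: partition_on_def)
qed

lemma finite_components_verts: "pair_graph H \<Longrightarrow> finite (components_verts H)"
  unfolding components_verts_def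
  by (intro fin_digraph.finite_sccs_verts pair_graph.pair_graphD_graph[THEN graph.axioms(1), THEN digraph.axioms(1)])

lemma components_verts_disjoint:
  "\<lbrakk>pair_graph H; S \<in> components_verts H; T \<in> components_verts H; S \<noteq> T\<rbrakk> \<Longrightarrow> S \<inter> T = {}"
  using partition_on_components_verts by (metis partition_onD2 disjointD)

lemma finite_component:
  assumes "pair_graph H" "S \<in> components_verts H"
  shows "finite S"
proof -
  interpret pair_graph H by fact
  show ?thesis
    using component_subset[OF assms] pair_finite_verts by (rule finite_subset)
qed

text \<open>Used contrapositively in \<open>S_setI\<close>: a second entry in the order sequence
  certifies disconnectedness.\<close>

lemma connected_imp_com_le_1:
  assumes "pair_graph H" "connected (with_proj H)"
  shows "com H \<le> 1"
proof -
  interpret pair_graph H by fact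
  have sc: "strongly_connected (with_proj H)"
    using symmetric_connected_imp_strongly_connected sym_arcs assms(2) by blast
  have "S = pverts H" if S: "S \<in> components_verts H" for S
  proof
    show "S \<subseteq> pverts H" by (rule component_subset[OF assms(1) S])
    show "pverts H \<subseteq> S"
    proof
      fix y assume y: "y \<in> pverts H"
      obtain x where x: "x \<in> S" "x \<in> pverts H"
        using component_nonempty[OF assms(1) S] component_subset[OF assms(1) S] by auto
      have "reachable (with_proj H) x y" "reachable (with_proj H) y x"
        using sc x(2) y unfolding strongly_connected_def with_proj_simps by blast+
      then show "y \<in> S"
        using S x(1) unfolding components_verts_def in_sccs_verts_conv_reachable by blast
    qed
  qed
  then have "components_verts H \<subseteq> {pverts H}" by blast
  then show ?thesis
    unfolding com_def using card_mono[of "{pverts H}" "components_verts H"] by simp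
qed

text \<open>A path starting in a closed set \<open>S\<close> never leaves it, so it uses only arcs
  with tail in \<open>S\<close>, and these survive in \<open>H'\<close>.\<close>

lemma reachable_closed_transfer:
  assumes "pair_graph H" "pair_graph H'" "pverts H' = pverts H"
    and closed: "\<And>x y. x \<in> S \<Longrightarrow> (x, y) \<in> parcs H \<Longrightarrow> y \<in> S"
    and arcs: "\<And>x y. x \<in> S \<Longrightarrow> (x, y) \<in> parcs H \<Longrightarrow> (x, y) \<in> parcs H'"
    and "reachable (with_proj H) x y" "x \<in> S"
  shows "reachable (with_proj H') x y"
proof -
  interpret H: pair_graph H by fact
  interpret H': pair_graph H' by fact
  have "y \<in> S \<and> reachable (with_proj H') x y"
    using assms(6)
  proof (induct rule: H.reachable_induct)
    case base
    then show ?case using assms(3,7) by auto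
  next
    case (step u w)
    then have "(u, w) \<in> parcs H" by simp
    with step closed arcs have "w \<in> S" "(u, w) \<in> parcs H'" by blast+
    with step show ?case by (meson H'.reachable_adjI H'.reachable_trans)
  qed
  then show ?thesis ..
qed

subsection \<open>The sequence of component orders\<close>

lemma mset_comp_seq: "mset (comp_seq H) = image_mset card (mset_set (components_verts H))"
  by (simp add: comp_seq_def)

lemma set_comp_seq: "pair_graph H \<Longrightarrow> set (comp_seq H) = card ` components_verts H"
  using arg_cong[OF mset_comp_seq[of H], of set_mset] finite_components_verts[of H] by simp

lemma sorted_comp_seq: "sorted_wrt (\<ge>) (comp_seq H)"
  by (simp add: comp_seq_def sorted_wrt_rev)

lemma length_comp_seq: "length (comp_seq H) = com H"
  by (metis com_def mset_comp_seq size_image_mset size_mset size_mset_set)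

lemma comp_seq_eqI:
  assumes "sorted_wrt (\<ge>) xs" "mset xs = image_mset card (mset_set (components_verts H))"
  shows "comp_seq H = xs"
proof -
  have "sort (rev xs) = rev xs"
    using assms(1) by (intro sorted_sort_id) (simp add: sorted_wrt_rev)
  then show ?thesis
    using assms(2) by (metis comp_seq_def mset_rev rev_rev_ident sorted_list_of_multiset_mset)
qed

lemma sum_list_comp_seq:
  assumes "pair_graph H"
  shows "sum_list (comp_seq H) = card (pverts H)"
proof -
  have "sum_list (comp_seq H) = (\<Sum>S\<in>components_verts H. card S)"
    by (metis mset_comp_seq sum_mset_sum_list sum_unfold_sum_mset)
  also have "\<dots> = card (pverts H)"
    using product_partition[OF partition_on_components_verts[OF assms]] finite_component[OF assms] 
    by metis
  finally show ?thesis .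
qed

text \<open>The orders \<open>a\<close> and \<open>b\<close> may coincide. Distinct components are
  still obtained because \<open>B\<close> is chosen after \<open>A\<close> has been removed, from
  what remains of the multiset.\<close>

lemma obtain_two_components:
  assumes "pair_graph H" "mset (comp_seq H) = {#a, b#} + M"
  obtains A B where "A \<in> components_verts H" "B \<in> components_verts H" "A \<noteq> B"
    "card A = a" "card B = b"
proof -
  define C where "C = components_verts H"
  have fin: "finite C" unfolding C_def by (rule finite_components_verts[OF assms(1)])
  have C: "image_mset card (mset_set C) = add_mset a (add_mset b M)"
    using assms(2) mset_comp_seq[of H] by (simp add: C_def)
  then have "a \<in># image_mset card (mset_set C)" by simp
  then obtain A where A: "A \<in> C" "card A = a" using fin by auto
  have "image_mset card (mset_set (C - {A})) = add_mset b M"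
    using C A mset_set.remove[OF fin A(1)] by simp
  then have "b \<in># image_mset card (mset_set (C - {A}))" by simp
  then obtain B where "B \<in> C - {A}" "card B = b" using fin by auto
  with A that show thesis unfolding C_def by blast
qed

lemma S_setI:
  assumes "pair_graph H" "spanning (with_proj H) (with_proj G)" "comp_seq H = a # b # cs" "a + b \<le> q"
  shows "H \<in> S_set q G"
proof -
  have "com H \<ge> 2" using assms(3) by (simp flip: length_comp_seq)
  then have "\<not> connected (with_proj H)" using connected_imp_com_le_1[OF assms(1)] by fastforce
  then show ?thesis using assms by (simp add: S_set_def comp_ord_def)
qed

text \<open>Makes the \<open>Max\<close> in \<open>ell\<close> a genuine maximum, so that it bounds
  the edge count of every member of \<open>S_set\<close>.\<close>

lemma finite_S_set:
  assumes "pair_graph G"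
  shows "finite (S_set q G)"
proof -
  interpret pair_graph G by fact
  have "S_set q G \<subseteq> (\<lambda>(V, E). \<lparr>pverts = V, parcs = E\<rparr>) ` (Pow (pverts G) \<times> Pow (parcs G))"
  proof
    fix H assume "H \<in> S_set q G"
    then have "pverts H \<subseteq> pverts G" "parcs H \<subseteq> parcs G"
      by (auto simp: S_set_def spanning_def subgraph_def)
    then show "H \<in> (\<lambda>(V, E). \<lparr>pverts = V, parcs = E\<rparr>) ` (Pow (pverts G) \<times> Pow (parcs G))"
      by (intro image_eqI[of _ _ "(pverts H, parcs H)"]) auto
  qed
  then show ?thesis
    by (rule finite_subset) (use pair_finite_verts pair_finite_arcs in auto)
qed

lemma num_edges_le_M_set:
  assumes "pair_graph G" "H \<in> M_set q G" "H' \<in> S_set q G"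
  shows "num_edges H' \<le> num_edges H"
  using assms finite_S_set[OF assms(1)] by (auto simp: M_set_def ell_def)

lemma M_setI:
  assumes "pair_graph G" "H \<in> M_set q G" "H' \<in> S_set q G" "num_edges H \<le> num_edges H'"
  shows "H' \<in> M_set q G"
  using num_edges_le_M_set[OF assms(1-3)] assms by (auto simp: M_set_def)

subsection \<open>Moving a vertex to another component\<close>

text \<open>All edges at \<open>v\<close> are deleted and \<open>v\<close> is joined to all its
  \<open>G\<close>-neighbours in \<open>A\<close>; the neighbour \<open>w\<close> ensures that there
  is one. The rest of \<open>B\<close> may fall apart, and \<open>N\<close> collects the fragments.
  The edge balance is written additively to avoid truncated subtraction.\<close>

lemma attach_vertex:
  assumes G: "pair_graph G" and H: "pair_graph H" and span: "spanning (with_proj H) (with_proj G)"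
    and A: "A \<in> components_verts H" and B: "B \<in> components_verts H" and "A \<noteq> B"
    and v: "v \<in> B" and w: "w \<in> A" "(v, w) \<in> parcs G"
  obtains H' N where "pair_graph H'" "spanning (with_proj H') (with_proj G)"
    "components_verts H' = insert (insert v A) (components_verts H - {A, B} \<union> N)"
    "N \<subseteq> Pow (B - {v})"
    "num_edges H + card {x \<in> A. (v, x) \<in> parcs G} \<le> num_edges H' + card {x \<in> B. (v, x) \<in> parcs G}"
proof -
  interpret G: pair_graph G by fact
  interpret H: pair_graph H by fact
  have VH: "pverts H = pverts G" and arcsH: "parcs H \<subseteq> parcs G"
    using span by (auto simp: spanning_def subgraph_def)
  have symG: "(y, x) \<in> parcs G" if "(x, y) \<in> parcs G" for x y
    using G.graph_symmetric that by auto
  have symH: "(y, x) \<in> parcs H" if "(x, y) \<in> parcs H" for x y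
    using H.graph_symmetric that by auto
  have Asub: "A \<subseteq> pverts G" and Bsub: "B \<subseteq> pverts G" using component_subset[OF H] A B VH by auto
  have AB: "A \<inter> B = {}" using components_verts_disjoint[OF H A B] \<open>A \<noteq> B\<close> by blast
  have vA: "v \<notin> A" using AB v by blast
  have finA: "finite A" and finB: "finite B" using finite_component[OF H] A B by auto
  note closedA = component_closed[OF H A] and closedB = component_closed[OF H B]
  \<comment> \<open>\<open>E0\<close> holds the arcs of \<open>H\<close> that avoid
    \<open>v\<close>, and \<open>F\<close> all arcs of \<open>G\<close> between \<open>v\<close> and
    \<open>A\<close>.\<close>
  define E0 where "E0 = {(x, y). (x, y) \<in> parcs H \<and> x \<noteq> v \<and> y \<noteq> v}"
  define F where "F = {(x, y). (x, y) \<in> parcs G \<and> (x = v \<and> y \<in> A \<or> x \<in> A \<and> y = v)}"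
  define H' where "H' = \<lparr>pverts = pverts G, parcs = E0 \<union> F\<rparr>"
  have VH': "pverts H' = pverts G" and arcsH': "parcs H' = E0 \<union> F" by (simp_all add: H'_def)
  have sub: "E0 \<union> F \<subseteq> parcs G" using arcsH by (auto simp: E0_def F_def)
  have H': "pair_graph H'"
  proof unfold_locales
    show "finite (pverts H')" using VH' G.pair_finite_verts by simp
    show "finite (parcs H')"
      unfolding arcsH' using sub G.pair_finite_arcs by (rule finite_subset)
    fix e assume "e \<in> parcs H'"
    then have "e \<in> parcs G" unfolding arcsH' using sub by (rule set_rev_mp)
    then show "fst e \<in> pverts H'" "snd e \<in> pverts H'" "fst e \<noteq> snd e"
      unfolding VH' by (rule G.arc_fst_in_verts G.arc_snd_in_verts G.pair_no_loops)+
  next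
    show "symmetric (with_proj H')"
      unfolding symmetric_def arcsH' with_proj_simps
      by (rule symI) (use symG symH in \<open>auto simp: E0_def F_def\<close>)
  qed
  interpret H': pair_graph H' by fact
  have span': "spanning (with_proj H') (with_proj G)"
    using sub VH' arcsH' G.wf_digraph H'.wf_digraph by (auto simp: spanning_def subgraph_def)
  note compH' = components_verts_iff[OF H']
  \<comment> \<open>By symmetry and closedness of \<open>B\<close>, an arc starting outside
    \<open>B\<close> also ends outside it, hence avoids \<open>v\<close>.\<close>
  have keep: "(x, y) \<in> parcs H'" if "(x, y) \<in> parcs H" "x \<notin> B" for x y
  proof -
    have "y \<notin> B" using that closedB symH by blast
    then show ?thesis using that v by (auto simp: arcsH' E0_def)
  qed
  have close': "y \<in> C" if "C \<in> components_verts H" "C \<noteq> A" "C \<noteq> B" "x \<in> C" "(x, y) \<in> parcs H'" for C x y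
  proof -
    have "C \<inter> A = {}" "C \<inter> B = {}" using components_verts_disjoint[OF H] that A B by blast+
    then have "(x, y) \<in> parcs H" using that v by (auto simp: arcsH' E0_def F_def)
    then show ?thesis using that component_closed[OF H] by blast
  qed
  have old: "C \<in> components_verts H'" if C: "C \<in> components_verts H" "C \<noteq> A" "C \<noteq> B" for C
  proof -
    have "C \<inter> B = {}" using components_verts_disjoint[OF H] C B by blast
    have "reachable (with_proj H') x y" if "x \<in> C" "y \<in> C" for x y
    proof (rule reachable_closed_transfer[OF H H' _ component_closed[OF H C(1)] keep])
      show "\<And>u. u \<in> C \<Longrightarrow> u \<notin> B" using \<open>C \<inter> B = {}\<close> by blast
    qed (use VH VH' that component_reachable[OF H C(1)] in auto)
    then show ?thesis
      unfolding compH' using close'[OF C] component_nonempty[OF H C(1)] component_subset[OF H C(1)] VH VH' by auto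
  qed
  have new: "insert v A \<in> components_verts H'"
  proof -
    have "reachable (with_proj H') x y" if "x \<in> A" "y \<in> A" for x y
    proof (rule reachable_closed_transfer[OF H H' _ closedA keep])
      show "\<And>u. u \<in> A \<Longrightarrow> u \<notin> B" using AB by blast
    qed (use VH VH' that component_reachable[OF H A] in auto)
    moreover have "reachable (with_proj H') v w" "reachable (with_proj H') w v"
      using w symG[OF w(2)] by (simp_all add: H'.reachable_adjI arcsH' F_def)
    moreover have "reachable (with_proj H') v v" using v Bsub VH' by auto
    ultimately have "\<forall>x\<in>insert v A. \<forall>y\<in>insert v A. reachable (with_proj H') x y"
      using w by (metis H'.reachable_trans insertE)
    moreover have "y \<in> insert v A" if "x \<in> insert v A" "(x, y) \<in> parcs H'" for x y
      using that vA closedA by (auto simp: arcsH' E0_def F_def)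
    ultimately show ?thesis unfolding compH' using v Asub Bsub VH' by auto
  qed
  \<comment> \<open>\<open>R\<close> consists of the components already identified. They cover every
    vertex outside \<open>B - {v}\<close>, so any further component lies inside that set.\<close>
  define R where "R = insert (insert v A) (components_verts H - {A, B})"
  define N where "N = components_verts H' - R"
  have "R \<subseteq> components_verts H'" using old new by (auto simp: R_def)
  have "N \<subseteq> Pow (B - {v})"
  proof
    fix C assume C: "C \<in> N"
    have notR: "u \<notin> D" if "D \<in> R" "u \<in> C" for D u
      using components_verts_disjoint[OF H', of C D] C that \<open>R \<subseteq> _\<close> unfolding N_def by auto
    have "u \<in> B - {v}" if u: "u \<in> C" for u
    proof -
      have "u \<in> pverts H" using C u component_subset[OF H', of C] VH VH' unfolding N_def by auto
      then obtain D where D: "D \<in> components_verts H" "u \<in> D"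
        using partition_onD1[OF partition_on_components_verts[OF H]] by auto
      have "u \<notin> insert v A" using notR[of "insert v A" u] u by (simp add: R_def)
      moreover have "D = A \<or> D = B" using notR[of D u] u D by (auto simp: R_def)
      ultimately show ?thesis using D by auto
    qed
    then show "C \<in> Pow (B - {v})" by blast
  qed
  moreover have "components_verts H' = insert (insert v A) (components_verts H - {A, B} \<union> N)"
    using \<open>R \<subseteq> _\<close> unfolding N_def R_def by blast
  moreover have "num_edges H + card {x \<in> A. (v, x) \<in> parcs G} \<le> num_edges H' + card {x \<in> B. (v, x) \<in> parcs G}"
  proof -
    \<comment> \<open>\<open>K\<close> is the set of edges avoiding \<open>v\<close>, common to both
      graphs. The other edges of \<open>H\<close> are among those from \<open>v\<close> to its
      \<open>G\<close>-neighbours in \<open>B\<close>; the other edges of \<open>H'\<close> are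
      exactly those from \<open>v\<close> to its \<open>G\<close>-neighbours in
      \<open>A\<close>.\<close>
    define K where "K = {{x, y} | x y. (x, y) \<in> E0}"
    have "K = (\<lambda>(x, y). {x, y}) ` E0" by (auto simp: K_def)
    moreover have "finite E0" by (rule finite_subset[OF _ H.pair_finite_arcs]) (auto simp: E0_def)
    ultimately have finK: "finite K" by simp
    have inj: "inj_on (\<lambda>x. {v, x}) X" for X by (rule inj_onI) (auto simp: doubleton_eq_iff)
    have "{{x, y} | x y. (x, y) \<in> parcs H} \<subseteq> K \<union> (\<lambda>x. {v, x}) ` {x \<in> B. (v, x) \<in> parcs G}"
    proof
      fix e assume "e \<in> {{x, y} | x y. (x, y) \<in> parcs H}"
      then obtain x y where e: "e = {x, y}" "(x, y) \<in> parcs H" by blast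
      consider "x = v" | "y = v" | "x \<noteq> v" "y \<noteq> v" by blast
      then show "e \<in> K \<union> (\<lambda>x. {v, x}) ` {x \<in> B. (v, x) \<in> parcs G}"
      proof cases
        case 1
        then have "e = {v, y}" "y \<in> B" "(v, y) \<in> parcs G"
          using e closedB[OF v, of y] arcsH by auto
        then show ?thesis by simp
      next
        case 2
        then have "e = {v, x}" "x \<in> B" "(v, x) \<in> parcs G"
          using e symH[OF e(2)] closedB[OF v, of x] arcsH by auto
        then show ?thesis by simp
      next
        case 3
        then have "(x, y) \<in> E0" using e by (simp add: E0_def)
        then show ?thesis using e by (auto simp: K_def)
      qed
    qed
    then have "num_edges H \<le> card (K \<union> (\<lambda>x. {v, x}) ` {x \<in> B. (v, x) \<in> parcs G})"
      unfolding num_edges_def using finK finB by (intro card_mono) auto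
    also have "\<dots> \<le> card K + card {x \<in> B. (v, x) \<in> parcs G}"
      using card_Un_le[of K "(\<lambda>x. {v, x}) ` {x \<in> B. (v, x) \<in> parcs G}"]
      by (simp add: card_image[OF inj])
    finally have 1: "num_edges H \<le> card K + card {x \<in> B. (v, x) \<in> parcs G}" .
    have "{{x, y} | x y. (x, y) \<in> F} = (\<lambda>x. {v, x}) ` {x \<in> A. (v, x) \<in> parcs G}"
    proof (intro equalityI subsetI)
      fix e assume "e \<in> {{x, y} | x y. (x, y) \<in> F}"
      then obtain x y where e: "e = {x, y}" "(x, y) \<in> F" by blast
      then have "e = {v, y} \<and> y \<in> A \<and> (v, y) \<in> parcs G \<or> e = {v, x} \<and> x \<in> A \<and> (v, x) \<in> parcs G"
        using symG[of x y] by (auto simp: F_def)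
      then show "e \<in> (\<lambda>x. {v, x}) ` {x \<in> A. (v, x) \<in> parcs G}" by auto
    next
      fix e assume "e \<in> (\<lambda>x. {v, x}) ` {x \<in> A. (v, x) \<in> parcs G}"
      then obtain x where "e = {v, x}" "(v, x) \<in> F" by (auto simp: F_def)
      then show "e \<in> {{x, y} | x y. (x, y) \<in> F}" by blast
    qed
    moreover have "{{x, y} | x y. (x, y) \<in> parcs H'} = K \<union> {{x, y} | x y. (x, y) \<in> F}"
      unfolding arcsH' K_def by blast
    ultimately have "num_edges H' = card (K \<union> (\<lambda>x. {v, x}) ` {x \<in> A. (v, x) \<in> parcs G})"
      unfolding num_edges_def by (simp only:)
    moreover have "v \<notin> e" if "e \<in> K" for e using that by (auto simp: K_def E0_def)
    then have "K \<inter> (\<lambda>x. {v, x}) ` {x \<in> A. (v, x) \<in> parcs G} = {}" by auto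
    then have "card (K \<union> (\<lambda>x. {v, x}) ` {x \<in> A. (v, x) \<in> parcs G}) =
        card K + card {x \<in> A. (v, x) \<in> parcs G}"
      using finK finA by (simp add: card_Un_disjoint card_image[OF inj])
    ultimately have "num_edges H' = card K + card {x \<in> A. (v, x) \<in> parcs G}" by simp
    with 1 show ?thesis by simp
  qed
  ultimately show thesis using that[OF H' span'] by simp
qed

text \<open>Since every entry of \<open>xs\<close> exceeds \<open>card A\<close>, the enlarged
  component keeps its position. Everything behind it is an old entry of \<open>ys\<close> or the
  order of a fragment of \<open>B - {v}\<close>, and fragments can only lengthen the tail.\<close>

lemma attach_vertex_comp_seq:
  assumes "pair_graph G" and H: "pair_graph H" and "spanning (with_proj H) (with_proj G)"
    and A: "A \<in> components_verts H" and B: "B \<in> components_verts H" and "A \<noteq> B"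
    and v: "v \<in> B" and w: "w \<in> A" "(v, w) \<in> parcs G"
    and seq: "comp_seq H = xs @ card A # card B # ys" and xs: "\<And>x. x \<in> set xs \<Longrightarrow> card A < x"
  obtains H' zs where "pair_graph H'" "spanning (with_proj H') (with_proj G)"
    "comp_seq H' = xs @ Suc (card A) # zs" "length ys \<le> length zs"
    "\<And>z. z \<in> set zs \<Longrightarrow> z \<in> set ys \<or> z < card B"
    "num_edges H + card {x \<in> A. (v, x) \<in> parcs G} \<le> num_edges H' + card {x \<in> B. (v, x) \<in> parcs G}"
proof -
  from attach_vertex[OF assms(1-9)] obtain H' N where
    H': "pair_graph H'" "spanning (with_proj H') (with_proj G)" and
    comp: "components_verts H' = insert (insert v A) (components_verts H - {A, B} \<union> N)" and
    N: "N \<subseteq> Pow (B - {v})" and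
    edges: "num_edges H + card {x \<in> A. (v, x) \<in> parcs G} \<le> num_edges H' + card {x \<in> B. (v, x) \<in> parcs G}" .
  define C where "C = components_verts H"
  note fin = finite_components_verts[OF H, folded C_def]
  have finA: "finite A" and finB: "finite B" using finite_component[OF H] A B by auto
  have finN: "finite N" using N finB by (meson finite_Diff finite_Pow_iff finite_subset)
  have "A \<inter> B = {}" using components_verts_disjoint[OF H A B] \<open>A \<noteq> B\<close> by blast
  then have vA: "v \<notin> A" using v by blast
  have disj: "S \<inter> B = {}" if "S \<in> C - {A, B}" for S
    using components_verts_disjoint[OF H _ B] that by (auto simp: C_def)
  have neC: "{} \<notin> C" using component_nonempty[OF H] by (auto simp: C_def)
  \<comment> \<open>Disjointness of the old components, the fragments and the enlarged component is
    what lets the multiset of orders split as a sum.\<close>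
  have CN: "(C - {A, B}) \<inter> N = {}"
  proof (rule equals0I)
    fix S assume S: "S \<in> (C - {A, B}) \<inter> N"
    then have "S \<inter> B = {}" "S \<subseteq> B" using disj N by auto
    then show False using S neC by (simp add: Int_absorb2)
  qed
  have notin: "insert v A \<notin> C - {A, B} \<union> N" using disj[of "insert v A"] N v by auto
  have "mset_set C = {#A, B#} + mset_set (C - {A, B})"
  proof -
    have "A \<in> C" "B \<in> C - {A}" using A B \<open>A \<noteq> B\<close> by (auto simp: C_def)
    moreover have "C - {A} - {B} = C - {A, B}" by auto
    ultimately show ?thesis
      using fin mset_set.remove[of C A] mset_set.remove[of "C - {A}" B] by simp
  qed
  then have old: "image_mset card (mset_set (C - {A, B})) = mset (xs @ ys)"
    using mset_comp_seq[of H] seq unfolding C_def by simp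
  define zs where "zs = rev (sort (ys @ sorted_list_of_multiset (image_mset card (mset_set N))))"
  have mzs: "mset zs = mset ys + image_mset card (mset_set N)"
    by (simp add: zs_def)
  have zs: "z \<in> set zs \<Longrightarrow> z \<in> set ys \<or> z < card B" for z
  proof -
    assume "z \<in> set zs"
    then have "z \<in> set ys \<or> z \<in> card ` N"
      using mzs finN by (metis set_mset_mset set_image_mset set_mset_union Un_iff finite_set_mset_mset_set)
    moreover have "card S < card B" if "S \<in> N" for S
      using that N v finB by (intro psubset_card_mono) auto
    ultimately show ?thesis by blast
  qed
  have srt: "sorted_wrt (\<ge>) (xs @ card A # card B # ys)" using sorted_comp_seq[of H] seq by simp
  have "comp_seq H' = xs @ Suc (card A) # zs"
  proof (rule comp_seq_eqI)
    have "sorted_wrt (\<ge>) zs" by (simp add: zs_def sorted_wrt_rev)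
    moreover have "z \<le> card A" if "z \<in> set zs" for z
      using zs[OF that] srt by (auto simp: sorted_wrt_append)
    ultimately show "sorted_wrt (\<ge>) (xs @ Suc (card A) # zs)"
      using srt xs by (fastforce simp: sorted_wrt_append Suc_le_eq less_imp_le le_SucI)
    show "mset (xs @ Suc (card A) # zs) = image_mset card (mset_set (components_verts H'))"
      using old mzs CN notin fin finN finA vA
      unfolding comp C_def[symmetric] by (simp add: mset_set_Union)
  qed
  moreover have "length ys \<le> length zs" by (simp add: zs_def)
  ultimately show thesis using that[OF H'] zs edges by simp
qed

subsection \<open>Complete multipartite graphs\<close>

text \<open>Sending each vertex to its class turns adjacency into inequality of function values, the
  form in which neighbours are counted in \<open>exists_degree_le\<close>.\<close>

lemma complete_multipartite_part_function:
  fixes G :: "'a pair_pre_digraph"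
  assumes "complete_multipartite G P"
  shows "\<exists>part :: 'a \<Rightarrow> 'a set. \<forall>u\<in>pverts G. \<forall>v\<in>pverts G. (u, v) \<in> parcs G \<longleftrightarrow> part u \<noteq> part v"
proof -
  have part: "partition_on (pverts G) P"
    and arcs: "parcs G = {(u, v). u \<in> pverts G \<and> v \<in> pverts G \<and> \<not> (\<exists>X\<in>P. u \<in> X \<and> v \<in> X)}"
    using assms by (auto simp: complete_multipartite_def)
  define f where "f u = (SOME X. X \<in> P \<and> u \<in> X)" for u
  have f: "f u \<in> P \<and> u \<in> f u" if "u \<in> pverts G" for u
    unfolding f_def by (rule someI_ex) (use part that in \<open>auto simp: partition_on_def\<close>)
  have unique: "f u = X" if "u \<in> pverts G" "X \<in> P" "u \<in> X" for u X
    using f[OF that(1)] that partition_onD2[OF part] by (auto simp: disjoint_def)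
  have "(u, v) \<in> parcs G \<longleftrightarrow> f u \<noteq> f v" if "u \<in> pverts G" "v \<in> pverts G" for u v
  proof -
    have "(\<exists>X\<in>P. u \<in> X \<and> v \<in> X) \<longleftrightarrow> f u = f v"
      using f[OF that(1)] f[OF that(2)] unique[OF that(1)] unique[OF that(2)] by metis
    then show ?thesis unfolding arcs using that by blast
  qed
  then show ?thesis by (intro exI[of _ f]) simp
qed

text \<open>Two distinct classes are nonempty and disjoint, so representatives of them are adjacent.
  This supplies the new edge when \<open>H\<close> has only trivial components.\<close>

lemma complete_multipartite_has_arc:
  assumes "complete_multipartite G P" "card P \<ge> 2"
  obtains u v where "(u, v) \<in> parcs G"
proof -
  have part: "partition_on (pverts G) P"
    and arcs: "parcs G = {(u, v). u \<in> pverts G \<and> v \<in> pverts G \<and> \<not> (\<exists>X\<in>P. u \<in> X \<and> v \<in> X)}"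
    using assms by (auto simp: complete_multipartite_def)
  obtain X Y where XY: "X \<in> P" "Y \<in> P" "X \<noteq> Y"
    using assms(2) by (metis One_nat_def card_le_Suc0_iff_eq card.infinite not_less_eq_eq numeral_2_eq_2 le_zero_eq nat.simps(3))
  then obtain u v where uv: "u \<in> X" "v \<in> Y" using partition_onD3[OF part] by fastforce
  have "\<not> (u \<in> Z \<and> v \<in> Z)" if "Z \<in> P" for Z
    using XY uv that partition_onD2[OF part] by (metis disjointD disjoint_iff)
  then have "(u, v) \<in> parcs G"
    unfolding arcs using XY uv partition_onD1[OF part] by auto
  then show thesis by (rule that)
qed

text \<open>
  If every \<open>v \<in> B\<close> had fewer neighbours in \<open>A\<close> than in \<open>B\<close>, then \<open>A\<close> would contain more vertices
  of each class met by \<open>B\<close> than \<open>B\<close> does, by a margin exceeding \<open>card A - card B\<close>.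
\<close>

lemma exists_degree_le:
  assumes "finite A" "finite B" "B \<noteq> {}" "card B \<le> card A"
  obtains v where "v \<in> B" "card {x \<in> B. f v \<noteq> f x} \<le> card {x \<in> A. f v \<noteq> f x}"
proof -
  have split: "card S = card {x \<in> S. f v \<noteq> f x} + card {x \<in> S. f x = f v}" if "finite S" for S v
  proof -
    have "card ({x \<in> S. f v \<noteq> f x} \<union> {x \<in> S. f x = f v}) = card {x \<in> S. f v \<noteq> f x} + card {x \<in> S. f x = f v}"
      by (rule card_Un_disjoint) (use that in auto)
    moreover have "{x \<in> S. f v \<noteq> f x} \<union> {x \<in> S. f x = f v} = S" by auto
    ultimately show ?thesis by simp
  qed
  have classes: "card S = (\<Sum>c\<in>f ` S. card {x \<in> S. f x = c})" if "finite S" for S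
    using sum.image_gen[OF that, of "\<lambda>_. 1::nat" f] by simp
  have "\<exists>v\<in>B. card {x \<in> B. f v \<noteq> f x} \<le> card {x \<in> A. f v \<noteq> f x}"
  proof (rule ccontr)
    assume "\<not> ?thesis"
    then have gt: "card {x \<in> A. f v \<noteq> f x} < card {x \<in> B. f v \<noteq> f x}" if "v \<in> B" for v
      using that by (simp add: not_le)
    \<comment> \<open>Passing to complements in \<open>A\<close> and \<open>B\<close> turns the
      deficit of neighbours into a surplus of vertices in the class of \<open>v\<close>.\<close>
    have lt: "card {x \<in> B. f x = f v} + (card A - card B) < card {x \<in> A. f x = f v}" if "v \<in> B" for v
      using split[OF assms(1), of v] split[OF assms(2), of v] assms(4) gt[OF that] by linarith
    obtain b where b: "b \<in> B" using assms(3) by blast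
    let ?g = "\<lambda>S c. card {x \<in> S. f x = c}"
    \<comment> \<open>The surplus in the class of \<open>b\<close> alone exceeds
      \<open>card A - card B\<close>. In every other class met by \<open>B\<close>, \<open>A\<close>
      has at least as many vertices as \<open>B\<close>, so \<open>A\<close> would have more than
      \<open>card A\<close> vertices.\<close>
    have "card A < ?g A (f b) + (\<Sum>c\<in>f ` B - {f b}. ?g A c)"
    proof -
      have "(\<Sum>c\<in>f ` B - {f b}. ?g B c) \<le> (\<Sum>c\<in>f ` B - {f b}. ?g A c)"
        using lt by (intro sum_mono) (fastforce intro: less_imp_le)
      moreover have "card B = ?g B (f b) + (\<Sum>c\<in>f ` B - {f b}. ?g B c)"
        using classes[OF assms(2)] b assms(2) sum.remove[of "f ` B" "f b" "?g B"] by simp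
      ultimately show ?thesis using lt[OF b] assms(4) by linarith
    qed
    also have "\<dots> = (\<Sum>c\<in>f ` B. ?g A c)"
      using b assms(2) sum.remove[of "f ` B" "f b" "?g A"] by simp
    also have "\<dots> = card (\<Union>c\<in>f ` B. {x \<in> A. f x = c})"
      using assms by (intro card_UN_disjoint[symmetric]) auto
    also have "\<dots> \<le> card A" using assms(1) by (intro card_mono) auto
    finally show False by simp
  qed
  with that show thesis by blast
qed

text \<open>The vertex given by \<open>exists_degree_le\<close> moves from the component of order
  \<open>b\<close> to that of order \<open>a\<close> without loss of edges. The bound
  \<open>a \<ge> 2\<close> guarantees it a neighbour there.\<close>

lemma enlarge_component:
  fixes G H :: "'a pair_pre_digraph"
  assumes mp: "complete_multipartite G P" and H: "pair_graph H"
    and span: "spanning (with_proj H) (with_proj G)"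
    and seq: "comp_seq H = xs @ a # b # ys" and xs: "\<And>x. x \<in> set xs \<Longrightarrow> a < x" and "a \<ge> 2"
  obtains H' zs where "pair_graph H'" "spanning (with_proj H') (with_proj G)"
    "comp_seq H' = xs @ Suc a # zs" "length ys \<le> length zs"
    "\<And>z. z \<in> set zs \<Longrightarrow> z \<in> set ys \<or> z < b" "num_edges H \<le> num_edges H'"
proof -
  have G: "pair_graph G" using mp by (simp add: complete_multipartite_def)
  interpret G: pair_graph G by fact
  interpret H: pair_graph H by fact
  have VH: "pverts H = pverts G" and arcsH: "parcs H \<subseteq> parcs G"
    using span by (auto simp: spanning_def subgraph_def)
  have symG: "(y, x) \<in> parcs G" if "(x, y) \<in> parcs G" for x y
    using G.graph_symmetric that by auto
  obtain part :: "'a \<Rightarrow> 'a set" where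
    "\<forall>u\<in>pverts G. \<forall>v\<in>pverts G. (u, v) \<in> parcs G \<longleftrightarrow> part u \<noteq> part v"
    using complete_multipartite_part_function[OF mp] ..
  then have part: "(u, v) \<in> parcs G \<longleftrightarrow> part u \<noteq> part v" if "u \<in> pverts G" "v \<in> pverts G" for u v
    using that by simp
  have "mset (comp_seq H) = {#a, b#} + mset (xs @ ys)" by (simp add: seq)
  then obtain A B where AB: "A \<in> components_verts H" "B \<in> components_verts H" "A \<noteq> B"
    and card: "card A = a" "card B = b"
    by (rule obtain_two_components[OF H])
  have sub: "A \<subseteq> pverts G" "B \<subseteq> pverts G" "B \<noteq> {}"
    using AB component_subset[OF H] component_nonempty[OF H] VH by auto
  have fin: "finite A" "finite B" using finite_component[OF H] AB by auto
  have "b \<le> a" using sorted_comp_seq[of H] seq by (simp add: sorted_wrt_append)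
  then obtain v where v: "v \<in> B" "card {x \<in> B. part v \<noteq> part x} \<le> card {x \<in> A. part v \<noteq> part x}"
    using exists_degree_le[OF fin sub(3)] card by metis
  then have deg: "card {x \<in> B. (v, x) \<in> parcs G} \<le> card {x \<in> A. (v, x) \<in> parcs G}"
    using part sub by (smt (verit, ccfv_SIG) Collect_cong subsetD)
  \<comment> \<open>A component with two vertices contains an arc, whose ends lie in different
    classes. At least one end is therefore outside the class of \<open>v\<close> and serves as
    \<open>w\<close>.\<close>
  obtain x y where xy: "x \<in> A" "y \<in> A" "x \<noteq> y"
    using \<open>a \<ge> 2\<close> card by (metis One_nat_def card_le_Suc0_iff_eq fin(1) not_less_eq_eq numeral_2_eq_2)
  then have "reachable (with_proj H) x y" using component_reachable[OF H AB(1)] by blast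
  then obtain z where z: "(x, z) \<in> parcs H"
    using xy by (auto elim: H.converse_reachable_cases)
  then have "z \<in> A" using component_closed[OF H AB(1)] xy by blast
  moreover have "part x \<noteq> part z" using z arcsH part sub xy \<open>z \<in> A\<close> by blast
  ultimately obtain w where "w \<in> A" "part v \<noteq> part w" using xy by metis
  then have w: "w \<in> A" "(v, w) \<in> parcs G" using part sub v by auto
  have seq': "comp_seq H = xs @ card A # card B # ys" and xs': "\<And>x. x \<in> set xs \<Longrightarrow> card A < x"
    using seq xs card by auto
  from attach_vertex_comp_seq[OF G H span AB v(1) w seq' xs'] obtain H' zs where
    "pair_graph H'" "spanning (with_proj H') (with_proj G)"
    "comp_seq H' = xs @ Suc (card A) # zs" "length ys \<le> length zs"
    "\<And>z. z \<in> set zs \<Longrightarrow> z \<in> set ys \<or> z < card B"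
    and edges: "num_edges H + card {x \<in> A. (v, x) \<in> parcs G} \<le> num_edges H' + card {x \<in> B. (v, x) \<in> parcs G}"
    by blast
  moreover from edges deg have "num_edges H \<le> num_edges H'" by linarith
  ultimately show thesis using that[of H' zs] card by simp
qed

subsection \<open>Extremal sequences\<close>

text \<open>A witness index cannot lie in the common prefix, nor at \<open>length xs\<close>, where
  the inequality goes the wrong way, nor beyond it, where the earlier entries would have to
  agree.\<close>

lemma not_succeq_at:
  assumes "x < y"
  shows "\<not> xs @ x # ys \<succeq> xs @ y # zs"
proof
  assume "xs @ x # ys \<succeq> xs @ y # zs"
  then consider "xs @ x # ys = xs @ y # zs"
    | i where "(xs @ x # ys) ! i > (xs @ y # zs) ! i" "\<forall>j<i. (xs @ x # ys) ! j = (xs @ y # zs) ! j"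
    unfolding seq_succeq_def by blast
  then show False
  proof cases
    case 1
    then show False using assms by simp
  next
    case (2 i)
    have "\<not> length xs < i" using 2(2) assms by (auto dest: spec[of _ "length xs"])
    moreover have "i \<noteq> length xs" using 2(1) assms by auto
    moreover have "\<not> i < length xs" using 2(1) by (auto simp: nth_append)
    ultimately show False by linarith
  qed
qed

theorem theorem3p5:
  fixes G H :: "'a pair_pre_digraph" and P :: "'a set set" and n q :: nat
  assumes "complete_multipartite G P"
    and "card P \<ge> 2"
    and "card (pverts G) = n"
    and "2 \<le> q" and "q \<le> n - 1"
    and "H \<in> M_set q G"
    and "\<forall>H' \<in> M_set q G. comp_ord 1 H \<ge> comp_ord 1 H'"
  shows "(com H \<ge> 3 \<and> comp_ord 1 H + comp_ord 3 H = q) \<and>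
    ((\<forall>H' \<in> M_set q G. comp_seq H \<succeq> comp_seq H') \<longrightarrow>
       (\<exists>h1 h2 h3 t. t \<ge> 1 \<and> h1 \<ge> h2 \<and> h2 \<ge> h3 \<and> (t = 1 \<longrightarrow> h3 = h2) \<and>
          comp_seq H = h1 # replicate t h2 @ [h3]) \<or>
       (\<exists>h1 h2 t1 t2. t1 \<ge> 2 \<and> t2 \<ge> 2 \<and> h1 \<ge> h2 \<and> h2 \<ge> 2 \<and>
          comp_seq H = h1 # replicate t1 h2 @ replicate t2 1))"
proof -
  have G: "pair_graph G" using assms(1) by (simp add: complete_multipartite_def)
  have H: "pair_graph H" and span: "spanning (with_proj H) (with_proj G)"
    and le_q: "comp_ord 1 H + comp_ord 2 H \<le> q"
    using assms(6) by (auto simp: M_set_def S_set_def)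
  interpret G: pair_graph G by fact
  have VH: "pverts H = pverts G"
    using span by (auto simp: spanning_def subgraph_def)
  have total: "sum_list (comp_seq H) = n" using sum_list_comp_seq[OF H] VH assms(3) by simp
  have sorted: "sorted_wrt (\<ge>) (comp_seq H)" by (rule sorted_comp_seq)
  have pos: "c > 0" if "c \<in> set (comp_seq H)" for c
    using that component_nonempty[OF H] finite_component[OF H]
    by (auto simp: set_comp_seq[OF H] card_gt_0_iff)
  have "q < n" using assms(4,5) by linarith
  \<comment> \<open>With at most two components the first two orders would sum to at least
    \<open>n > q\<close>. If there is only one, \<open>comp_ord 2 H\<close> is unspecified, but
    \<open>comp_ord 1 H = n\<close> already suffices.\<close>
  have "\<exists>c1 c2 c3 cs. comp_seq H = c1 # c2 # c3 # cs"
  proof (rule ccontr)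
    assume no: "\<not> ?thesis"
    have "n \<le> comp_ord 1 H + comp_ord 2 H"
    proof (cases "comp_seq H")
      case Nil
      then show ?thesis using total by simp
    next
      case (Cons c1 l)
      then show ?thesis
        using no total by (cases l; cases "tl l") (auto simp: comp_ord_def)
    qed
    then show False using le_q \<open>q < n\<close> by linarith
  qed
  then obtain c1 c2 c3 cs where seq: "comp_seq H = c1 # c2 # c3 # cs" by blast
  have ord: "comp_ord 1 H = c1" "comp_ord 2 H = c2" "comp_ord 3 H = c3"
    using seq by (simp_all add: comp_ord_def)
  have le: "c2 \<le> c1" "c3 \<le> c2" "\<And>c. c \<in> set cs \<Longrightarrow> c \<le> c3" using sorted seq by auto
  have c13: "c1 + c3 = q"
  proof (rule ccontr)
    assume "c1 + c3 \<noteq> q"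
    then have lt: "c1 + c3 < q" using le_q ord le by linarith
    show False
    proof (cases "c1 \<ge> 2")
      case True
      from enlarge_component[OF assms(1) H span, of "[]" c1 c2 "c3 # cs"] seq True
      obtain H' zs where H': "pair_graph H'" "spanning (with_proj H') (with_proj G)"
        and seq': "comp_seq H' = Suc c1 # zs" and len: "length (c3 # cs) \<le> length zs"
        and zs: "\<And>z. z \<in> set zs \<Longrightarrow> z \<in> set (c3 # cs) \<or> z < c2"
        and edges: "num_edges H \<le> num_edges H'"
        by auto
      obtain z zs' where z: "zs = z # zs'" using len by (cases zs) auto
      \<comment> \<open>Either alternative leaves room for \<open>Suc c1\<close>: the first by
        \<open>c1 + c3 < q\<close>, the second by \<open>c1 + c2 \<le> q\<close>. So
        \<open>H'\<close> is a member of \<open>M_set q G\<close> with a larger first order.\<close>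
      have "z \<le> c3 \<or> z < c2" using zs[of z] z le(3)[of z] by auto
      then have "Suc c1 + z \<le> q" using lt le_q ord by linarith
      then have "H' \<in> S_set q G" using S_setI[OF H'] seq' z by simp
      then have "H' \<in> M_set q G" using M_setI[OF G assms(6)] edges by simp
      then have "comp_ord 1 H' \<le> c1" using assms(7) ord by simp
      then show False using seq' by (simp add: comp_ord_def)
    next
      case False
      \<comment> \<open>\<open>H\<close> has no edges at all, but \<open>q \<ge> 3\<close> leaves room for one\<close>
      have one: "c = 1" if "c \<in> set (comp_seq H)" for c
      proof -
        have "c \<le> c1" using that le seq by force
        then show ?thesis using pos[OF that] False by linarith
      qed
      obtain v w where vw: "(v, w) \<in> parcs G" using complete_multipartite_has_arc[OF assms(1,2)] .
      then have "v \<in> pverts H" "w \<in> pverts H"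
        using G.arc_fst_in_verts[OF vw] G.arc_snd_in_verts[OF vw] VH by auto
      then obtain A B where AB: "A \<in> components_verts H" "B \<in> components_verts H" and mem: "w \<in> A" "v \<in> B"
        using partition_onD1[OF partition_on_components_verts[OF H]] by auto
      have card: "card A = 1" "card B = 1"
        using one AB unfolding set_comp_seq[OF H] by auto
      then have singl: "A = {w}" "B = {v}" using mem by (auto simp: card_1_singleton_iff)
      have "v \<noteq> w" using G.pair_no_loops[OF vw] by simp
      then have "A \<noteq> B" using singl by simp
      have "comp_seq H = [] @ card A # card B # c3 # cs"
        using seq one[of c1] one[of c2] card by simp
      from attach_vertex_comp_seq[OF G H span AB \<open>A \<noteq> B\<close> mem(2,1) vw this]
      obtain H' zs where H': "pair_graph H'" "spanning (with_proj H') (with_proj G)"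
        and seq': "comp_seq H' = Suc (card A) # zs" and len: "length (c3 # cs) \<le> length zs"
        and zs: "\<And>z. z \<in> set zs \<Longrightarrow> z \<in> set (c3 # cs) \<or> z < card B"
        and edges: "num_edges H + card {x \<in> A. (v, x) \<in> parcs G} \<le> num_edges H' + card {x \<in> B. (v, x) \<in> parcs G}"
        by auto
      obtain z zs' where z: "zs = z # zs'" using len by (cases zs) auto
      have "z \<le> 1" using zs[of z] z one[of z] card seq by auto
      moreover have "c1 = 1" "c3 = 1" using one seq by auto
      ultimately have "2 + z \<le> q" using lt by linarith
      then have "H' \<in> S_set q G" using S_setI[OF H'] seq' z card by simp
      \<comment> \<open>Joining the isolated vertices \<open>v\<close> and \<open>w\<close> gains
        one edge and loses none. The contradiction here is with the maximal edge count, not with the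
        choice of \<open>or_1\<close>.\<close>
      moreover have nbrs: "{x \<in> A. (v, x) \<in> parcs G} = {w}" "{x \<in> B. (v, x) \<in> parcs G} = {}"
        using singl vw G.pair_no_loops[of "(v, v)"] by auto
      have "num_edges H < num_edges H'" using edges unfolding nbrs by simp
      ultimately show False using num_edges_le_M_set[OF G assms(6)] by fastforce
    qed
  qed
  have "com H \<ge> 3" using seq by (simp flip: length_comp_seq)
  moreover have "(\<exists>h1 h2 h3 t. t \<ge> 1 \<and> h1 \<ge> h2 \<and> h2 \<ge> h3 \<and> (t = 1 \<longrightarrow> h3 = h2) \<and>
          comp_seq H = h1 # replicate t h2 @ [h3]) \<or>
       (\<exists>h1 h2 t1 t2. t1 \<ge> 2 \<and> t2 \<ge> 2 \<and> h1 \<ge> h2 \<and> h2 \<ge> 2 \<and>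
          comp_seq H = h1 # replicate t1 h2 @ replicate t2 1)"
    (is "?form1 \<or> ?form2")
    if max: "\<forall>H' \<in> M_set q G. comp_seq H \<succeq> comp_seq H'"
  proof -
    have "c3 = c2" using c13 le_q ord le by linarith
    \<comment> \<open>\<open>t\<close> is the length of the maximal run of \<open>c2\<close> after
      the first entry, at least 2 as \<open>c3 = c2\<close>; the two forms are told apart by what
      follows it.\<close>
    define rest where "rest = dropWhile (\<lambda>c. c = c2) (c2 # c3 # cs)"
    define t where "t = length (takeWhile (\<lambda>c. c = c2) (c2 # c3 # cs))"
    have "takeWhile (\<lambda>c. c = c2) (c2 # c3 # cs) = replicate t c2"
      unfolding t_def by (rule replicate_eqI) (auto dest: set_takeWhileD)
    then have split: "comp_seq H = c1 # replicate t c2 @ rest"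
      unfolding seq rest_def by (metis takeWhile_dropWhile_id)
    have "t \<ge> 2" unfolding t_def using \<open>c3 = c2\<close> by simp
    have sorted': "sorted_wrt (\<ge>) (c1 # replicate t c2 @ rest)" using sorted split by simp
    consider "rest = []" | a where "rest = [a]" | a b ys where "rest = a # b # ys"
      by (metis list.exhaust)
    then show ?thesis
    proof cases
      case 1
      \<comment> \<open>With nothing after the run, its last copy of \<open>c2\<close> plays the
        role of \<open>h3\<close>, which also meets the requirement for a run of length 1.\<close>
      have "replicate t c2 = replicate (t - 1) c2 @ [c2]"
        using \<open>t \<ge> 2\<close> by (cases t) (auto simp: replicate_append_same)
      then have "comp_seq H = c1 # replicate (t - 1) c2 @ [c2]" using split 1 by simp
      then have ?form1 using \<open>t \<ge> 2\<close> le(1)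
        by (intro exI[of _ c1] exI[of _ c2] exI[of _ "t - 1"]) auto
      then show ?thesis ..
    next
      case (2 a)
      have "a \<le> c2" using sorted' 2 \<open>t \<ge> 2\<close> by (auto simp: sorted_wrt_append)
      then have ?form1 using split 2 \<open>t \<ge> 2\<close> le(1)
        by (intro exI[of _ c1] exI[of _ c2] exI[of _ a] exI[of _ t]) auto
      then show ?thesis ..
    next
      case (3 a b ys)
      have "a \<noteq> c2" using hd_dropWhile[of "\<lambda>c. c = c2" "c2 # c3 # cs"] 3 unfolding rest_def by auto
      moreover have "a \<le> c2" using sorted' 3 \<open>t \<ge> 2\<close> by (auto simp: sorted_wrt_append)
      ultimately have "a < c2" by simp
      show ?thesis
      proof (cases "a \<ge> 2")
        case True
        have xs: "x \<in> set (c1 # replicate t c2) \<Longrightarrow> a < x" for x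
          using \<open>a < c2\<close> le(1) by (auto split: if_splits)
        have seq_a: "comp_seq H = (c1 # replicate t c2) @ a # b # ys" using split 3 by simp
        from enlarge_component[OF assms(1) H span seq_a xs True]
        obtain H' zs where H': "pair_graph H'" "spanning (with_proj H') (with_proj G)"
          and seq': "comp_seq H' = (c1 # replicate t c2) @ Suc a # zs"
          and edges: "num_edges H \<le> num_edges H'"
          by blast
        \<comment> \<open>Unfolding one copy of \<open>c2\<close> shows that the two leading orders
          are still \<open>c1\<close> and \<open>c2\<close>, so the bound by \<open>q\<close> is
          unaffected by the move further down.\<close>
        obtain t' where t': "t = Suc t'" using \<open>t \<ge> 2\<close> by (cases t) auto
        have "H' \<in> S_set q G"
          using S_setI[OF H', of c1 c2 "replicate t' c2 @ Suc a # zs"] seq' t' le_q ord by simp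
        then have "H' \<in> M_set q G" using M_setI[OF G assms(6)] edges by simp
        then have "(c1 # replicate t c2) @ a # b # ys \<succeq> (c1 # replicate t c2) @ Suc a # zs"
          using max seq' seq_a by metis
        then show ?thesis using not_succeq_at[of a "Suc a"] by blast
      next
        case False
        \<comment> \<open>Entries of \<open>rest\<close> are positive and at most
          \<open>a < 2\<close>. As \<open>rest\<close> has at least two entries, this gives
          \<open>t2 \<ge> 2\<close>.\<close>
        have "c = 1" if "c \<in> set rest" for c
        proof -
          have "c \<le> a" using sorted' that 3 by (auto simp: sorted_wrt_append)
          moreover have "c > 0" using pos that split by simp
          ultimately show ?thesis using False by linarith
        qed
        then have "rest = replicate (length rest) 1" by (intro replicate_eqI) auto
        moreover have "c2 \<ge> 2" using \<open>a < c2\<close> pos[of a] split 3 by simp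
        ultimately have ?form2 using split \<open>t \<ge> 2\<close> le(1) 3
          by (intro exI[of _ c1] exI[of _ c2] exI[of _ t] exI[of _ "length rest"]) auto
        then show ?thesis ..
      qed
    qed
  qed
  ultimately show ?thesis using c13 ord by simp
qed

end
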